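(* Let $r,D$ be positive integers and let $F:\mathbb{Z}^r\to\mathbb{Z}$ be periodic with period $D$ in each component. Let $\xi\in\mathbb{C}$ satisfy $\xi^D=1$ (not necessarily primitive). For $n\ge0$ define $$S(n)=\sum_{q_1=0}^n\sum_{q_2=0}^{n-q_1}\cdots\sum_{q_r=0}^{n-q_1-\cdots-q_{r-1}} \binom{n}{q_1}\binom{n-q_1}{q_2}\cdots\binom{n-q_1-\cdots -q_{r-1}}{q_r}\xi^{F(q_1,\dots,q_r)}.$$ Then $$ S(n)=\sum_{j_1=0}^{D-1}\sum_{j_2=0}^{j_1}\cdots \sum_{j_r=0}^{j_{r-1}}c_{j_1,\dots,j_r}(D)\left(1+\xi_D^{-j_1}+\cdots+\xi_D^{-j_r}\right)^n,$$ where $$ c_{j_1,\dots, j_r}(D)=\frac{1}{D^r}\sum_{b_r=0}^{D-1}\cdots \sum_{b_1=0}^{D-1} \xi^{F(b_1,\dots,b_r)}\sum_{(j_1',\dots,j_r')\in \mathrm{Sym}(j_1,\dots, j_r)}\xi_D^{j_1'b_r+\cdots+j_r' b_1},$$ and $\xi_D=\exp(2\pi i/D)$.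
   Context: $F$ periodic with period $D$ in each component means $F(q_1,\dots,q_j+D,\dots,q_r)=F(q_1,\dots,q_r)$ for all $j$ and all integer tuples. $\mathrm{Sym}(j_1,\dots,j_r)$ denotes the set of all distinct rearrangements (permutations of the entries) of the tuple $(j_1,\dots,j_r)$. *)

theory Defs
  imports Complex_Main "HOL-Combinatorics.Multiset_Permutations"
begin

text \<open>
  An element of \<open>\<int>\<^sup>r\<close> is an integer list of length \<open>r\<close>, and the \<open>k\<close>-th component of a tuple is
  the list entry at position \<open>k - 1\<close>.  A map \<open>F\<close> on \<open>\<int>\<^sup>r\<close> is a function on integer lists of which
  only the values on lists of length \<open>r\<close> are used.
\<close>

definition periodic_in_each :: "nat \<Rightarrow> nat \<Rightarrow> (int list \<Rightarrow> int) \<Rightarrow> bool" where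
  "periodic_in_each r D F \<longleftrightarrow>
     (\<forall>q. length q = r \<longrightarrow> (\<forall>j<r. F (q[j := q ! j + int D]) = F q))"

text \<open>
  \<open>nested_sum R r f\<close> is the \<open>r\<close>-fold iterated sum of \<open>f [x\<^sub>1, \<dots>, x\<^sub>r]\<close> over
  \<open>x\<^sub>1 \<in> R []\<close>, \<open>x\<^sub>2 \<in> R [x\<^sub>1]\<close>, \<open>\<dots>\<close>, \<open>x\<^sub>r \<in> R [x\<^sub>1, \<dots>, x\<^sub>r\<^sub>-\<^sub>1]\<close>, with \<open>x\<^sub>1\<close> outermost:
  \<open>R\<close> maps the outer summation variables to the range of the next one.
\<close>

primrec nested_sum ::
    "(nat list \<Rightarrow> nat set) \<Rightarrow> nat \<Rightarrow> (nat list \<Rightarrow> 'a::comm_monoid_add) \<Rightarrow> 'a" where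
  "nested_sum R 0 f = f []"
| "nested_sum R (Suc r) f =
     (\<Sum>x\<in>R []. nested_sum (\<lambda>xs. R (x # xs)) r (\<lambda>xs. f (x # xs)))"

text \<open>
  The truncated subtractions are harmless: on the range of summation
  \<open>q\<^sub>1 + \<dots> + q\<^sub>i \<le> n\<close> for all \<open>i\<close>.
\<close>

definition exp_binom_sum :: "nat \<Rightarrow> (int list \<Rightarrow> int) \<Rightarrow> complex \<Rightarrow> nat \<Rightarrow> complex" where
  "exp_binom_sum r F \<xi> n =
     nested_sum (\<lambda>q. {0..n - sum_list q}) r
       (\<lambda>q. (\<Prod>i<r. of_nat ((n - sum_list (take i q)) choose (q ! i))) * \<xi> powi F (map int q))"

definition root_unity :: "nat \<Rightarrow> complex" where
  "root_unity D = exp (2 * of_real pi * \<i> / of_nat D)"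

text \<open>
  The variable of the iterated sum is the reversed tuple \<open>c = [b\<^sub>r, \<dots>, b\<^sub>1]\<close> (the sum over \<open>b\<^sub>r\<close> is
  the outermost one), so \<open>F\<close> is taken at \<open>rev c = [b\<^sub>1, \<dots>, b\<^sub>r]\<close> and the exponent
  \<open>\<Sum>i<r. j' ! i * c ! i\<close> is \<open>j'\<^sub>1 b\<^sub>r + \<dots> + j'\<^sub>r b\<^sub>1\<close>.  The distinct rearrangements of \<open>j\<close> are the
  lists in \<open>permutations_of_multiset (mset j)\<close>.
\<close>

definition coeff_c ::
    "nat \<Rightarrow> nat \<Rightarrow> (int list \<Rightarrow> int) \<Rightarrow> complex \<Rightarrow> nat list \<Rightarrow> complex" where
  "coeff_c r D F \<xi> j =
     1 / of_nat D ^ r *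
     nested_sum (\<lambda>_. {0..D - 1}) r
       (\<lambda>c. \<xi> powi F (map int (rev c)) *
            (\<Sum>j' \<in> permutations_of_multiset (mset j). root_unity D ^ (\<Sum>i<r. j' ! i * c ! i)))"

end

theory Submission
  imports Defs
begin

text \<open>
  The discrete Fourier transform on \<open>(\<int>/D)\<^sup>r\<close> writes the periodic function \<open>q \<mapsto> \<xi>\<^bsup>F(q)\<^esup>\<close> as a
  combination of the characters \<open>q \<mapsto> \<xi>\<^sub>D\<^bsup>-k\<cdot>q\<^esup>\<close>, \<open>k \<in> {0..D-1}\<^sup>r\<close>.  By the multinomial theorem, the
  character of \<open>k\<close> contributes \<open>(1 + \<xi>\<^sub>D\<^bsup>-k\<^sub>1\<^esup> + \<dots> + \<xi>\<^sub>D\<^bsup>-k\<^sub>r\<^esup>)\<^sup>n\<close> to the sum.  This depends only on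
  the multiset of the entries of \<open>k\<close>, so the frequencies \<open>k\<close> may be grouped by their weakly
  decreasing rearrangement.
\<close>

subsection \<open>Iterated sums\<close>

lemma nested_sum_cong:
  assumes "\<And>xs. length xs = r \<Longrightarrow> f xs = g xs"
  shows "nested_sum R r f = nested_sum R r g"
  using assms
proof (induction r arbitrary: R f g)
  case (Suc r)
  show ?case
    unfolding nested_sum.simps by (intro sum.cong refl Suc.IH) (simp add: Suc.prems)
qed simp

lemma nested_sum_sum_distrib:
  "nested_sum R r (\<lambda>q. \<Sum>k\<in>K. f k q) = (\<Sum>k\<in>K. nested_sum R r (f k))"
proof (induction r arbitrary: R f)
  case (Suc r)
  then show ?case by simp (rule sum.swap)
qed simp

lemma nested_sum_distrib_left:
  fixes c :: "'a::semiring_0"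
  shows "nested_sum R r (\<lambda>q. c * f q) = c * nested_sum R r f"
  by (induction r arbitrary: R f) (simp_all add: sum_distrib_left)

text \<open>Splitting off the head of the list turns the index set for \<open>Suc r\<close> into the
  image of a dependent sum under Cons. Finiteness is carried through the same induction because
  \<open>sum.Sigma\<close> requires it of every fibre.\<close>

lemma nested_sum_conv_sum:
  assumes "\<And>xs. finite (R xs)"
  shows "finite {xs. length xs = r \<and> (\<forall>i<r. xs ! i \<in> R (take i xs))} \<and>
    nested_sum R r f = sum f {xs. length xs = r \<and> (\<forall>i<r. xs ! i \<in> R (take i xs))}"
  using assms
proof (induction r arbitrary: R f)
  case 0
  have "{xs. length xs = 0 \<and> (\<forall>i<0. xs ! i \<in> R (take i xs))} = {[]}" by auto
  then show ?case by simp
next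
  case (Suc r)
  define T where "T x = {xs. length xs = r \<and> (\<forall>i<r. xs ! i \<in> R (x # take i xs))}" for x
  have fin: "finite (T x)" and IH: "nested_sum (\<lambda>xs. R (x # xs)) r g = sum g (T x)"
    for x and g :: "nat list \<Rightarrow> 'a"
    using Suc.IH[of "\<lambda>xs. R (x # xs)" g] Suc.prems by (auto simp: T_def)
  have eq: "{xs. length xs = Suc r \<and> (\<forall>i<Suc r. xs ! i \<in> R (take i xs))} =
      (\<lambda>(x, xs). x # xs) ` Sigma (R []) T" (is "?L = ?M")
  proof (rule set_eqI)
    fix ys :: "nat list"
    show "ys \<in> ?L \<longleftrightarrow> ys \<in> ?M"
      by (cases ys) (auto simp: T_def All_less_Suc2)
  qed
  have "sum f ?M = (\<Sum>x\<in>R []. \<Sum>xs\<in>T x. f (x # xs))"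
    using Suc.prems fin
    by (subst sum.reindex) (auto simp: inj_on_def sum.Sigma case_prod_unfold)
  then show ?case
    unfolding eq using fin Suc.prems by (auto simp: IH)
qed

lemma nested_sum_const_range:
  "nested_sum (\<lambda>_. {..<D}) r f = sum f {xs. set xs \<subseteq> {..<D} \<and> length xs = r}"
proof -
  have "{xs. length xs = r \<and> (\<forall>i<r. xs ! i \<in> {..<D})} = {xs. set xs \<subseteq> {..<D} \<and> length xs = r}"
    by (auto simp: subset_iff in_set_conv_nth)
  then show ?thesis
    using nested_sum_conv_sum[of "\<lambda>_. {..<D}" r f] by simp
qed

text \<open>Each range compares a variable only with its predecessor; transitivity turns these
  adjacent comparisons into sortedness. The bound \<open>D - 1\<close> on the first entry, which
  means \<open>< D\<close> because \<open>D > 0\<close>, propagates to all later entries.\<close>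

lemma nested_sum_decreasing:
  assumes "D > 0"
  shows "nested_sum (\<lambda>j. {0..if j = [] then D - 1 else last j}) r f =
    sum f {xs. set xs \<subseteq> {..<D} \<and> length xs = r \<and> sorted_wrt (\<ge>) xs}"
proof -
  have "{xs. length xs = r \<and>
        (\<forall>i<r. xs ! i \<in> {0..if take i xs = [] then D - 1 else last (take i xs)})} =
      {xs. set xs \<subseteq> {..<D} \<and> length xs = r \<and> sorted_wrt (\<ge>) xs}" (is "?L = ?M")
  proof (intro set_eqI iffI)
    fix xs assume "xs \<in> ?L"
    then have len: "length xs = r"
      and le: "\<And>i. i < r \<Longrightarrow> xs ! i \<le> (if take i xs = [] then D - 1 else last (take i xs))"
      by auto
    have step: "xs ! Suc i \<le> xs ! i" if "Suc i < r" for i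
    proof -
      have "take (Suc i) xs \<noteq> []" "last (take (Suc i) xs) = xs ! i"
        using that len by (auto simp: take_Suc_conv_app_nth)
      then show ?thesis using le[OF that] by simp
    qed
    then have sorted: "sorted_wrt (\<ge>) xs"
      using len by (subst sorted_wrt_iff_nth_Suc_transp) (auto simp: transp_def)
    have "xs ! i < D" if "i < r" for i
      using that
    proof (induction i)
      case 0
      then show ?case using le[of 0] assms by simp
    next
      case (Suc i)
      then show ?case using step[of i] by linarith
    qed
    then show "xs \<in> ?M" using len sorted by (auto simp: in_set_conv_nth)
  next
    fix xs assume xs: "xs \<in> ?M"
    have "xs ! i \<le> (if take i xs = [] then D - 1 else last (take i xs))" if i: "i < r" for i
    proof (cases i)
      case 0
      then have "xs ! 0 < D" using xs i nth_mem[of 0 xs] by (auto simp del: nth_mem)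
      then show ?thesis using 0 xs i by auto
    next
      case (Suc k)
      then have "last (take i xs) = xs ! k" "take i xs \<noteq> []"
        using xs i by (auto simp: take_Suc_conv_app_nth)
      then show ?thesis
        using xs i Suc by (auto simp: sorted_wrt_iff_nth_less)
    qed
    then show "xs \<in> ?L" using xs by auto
  qed
  then show ?thesis
    using nested_sum_conv_sum[of "\<lambda>j. {0..if j = [] then D - 1 else last j}" r f] by simp
qed

text \<open>The product of binomials is a multinomial coefficient. Once the first variable is fixed
  at \<open>x\<close>, what remains is the same sum for \<open>n - x\<close> and the shifted
  \<open>z\<close>, so the binomial theorem separates \<open>z 0\<close> from the rest.\<close>

lemma nested_sum_multinomial:
  fixes z :: "nat \<Rightarrow> 'a::comm_ring_1"
  shows "nested_sum (\<lambda>q. {0..n - sum_list q}) r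
       (\<lambda>q. (\<Prod>i<r. of_nat ((n - sum_list (take i q)) choose (q ! i))) * (\<Prod>i<r. z i ^ (q ! i))) =
     (1 + (\<Sum>i<r. z i)) ^ n"
proof (induction r arbitrary: n z)
  case 0
  then show ?case by simp
next
  case (Suc r)
  let ?P = "\<lambda>m q. (\<Prod>i<r. of_nat ((m - sum_list (take i q)) choose (q ! i))) *
    (\<Prod>i<r. z (Suc i) ^ (q ! i))"
  have "nested_sum (\<lambda>xs. {0..n - sum_list (x # xs)}) r
       (\<lambda>xs. (\<Prod>i<Suc r. of_nat ((n - sum_list (take i (x # xs))) choose ((x # xs) ! i))) *
          (\<Prod>i<Suc r. z i ^ ((x # xs) ! i))) =
     of_nat (n choose x) * z 0 ^ x * (1 + (\<Sum>i<r. z (Suc i))) ^ (n - x)" for x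
  proof -
    have "(\<lambda>xs. (\<Prod>i<Suc r. of_nat ((n - sum_list (take i (x # xs))) choose ((x # xs) ! i))) *
          (\<Prod>i<Suc r. z i ^ ((x # xs) ! i))) =
        (\<lambda>xs. of_nat (n choose x) * z 0 ^ x * ?P (n - x) xs)"
      by (simp only: prod.lessThan_Suc_shift) (simp add: algebra_simps)
    then show ?thesis
      using Suc.IH[of "n - x" "\<lambda>i. z (Suc i)"]
      by (simp add: nested_sum_distrib_left)
  qed
  then have "nested_sum (\<lambda>q. {0..n - sum_list q}) (Suc r)
       (\<lambda>q. (\<Prod>i<Suc r. of_nat ((n - sum_list (take i q)) choose (q ! i))) *
          (\<Prod>i<Suc r. z i ^ (q ! i))) =
      (\<Sum>x=0..n. of_nat (n choose x) * z 0 ^ x * (1 + (\<Sum>i<r. z (Suc i))) ^ (n - x))"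
    by (simp del: prod.lessThan_Suc)
  also have "\<dots> = (z 0 + (1 + (\<Sum>i<r. z (Suc i)))) ^ n"
    by (simp add: binomial_ring atLeast0AtMost)
  also have "\<dots> = (1 + (\<Sum>i<Suc r. z i)) ^ n"
    by (simp only: sum.lessThan_Suc_shift) (simp add: algebra_simps)
  finally show ?case .
qed

text \<open>Expanding the right-hand product chooses one exponent per coordinate, that is, a list
  \<open>k\<close>. This reduces character sums in \<open>r\<close> dimensions to geometric
  sums.\<close>

lemma sum_lists_prod_power:
  fixes z :: "nat \<Rightarrow> 'a::comm_semiring_1"
  shows "(\<Sum>k | set k \<subseteq> {..<D} \<and> length k = r. \<Prod>i<r. z i ^ (k ! i)) = (\<Prod>i<r. \<Sum>x<D. z i ^ x)"
proof -
  have "nested_sum (\<lambda>_. {..<D}) r (\<lambda>k. \<Prod>i<r. z i ^ (k ! i)) = (\<Prod>i<r. \<Sum>x<D. z i ^ x)"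
  proof (induction r arbitrary: z)
    case 0
    then show ?case by simp
  next
    case (Suc r)
    show ?case
      using Suc.IH[of "\<lambda>i. z (Suc i)"]
      by (simp add: prod.lessThan_Suc_shift nested_sum_distrib_left sum_distrib_right
          del: prod.lessThan_Suc)
  qed
  then show ?thesis by (simp only: nested_sum_const_range)
qed

subsection \<open>The discrete Fourier transform\<close>

lemma root_unity_power: "root_unity D ^ k = cis (2 * pi * real k / real D)"
proof -
  have "root_unity D = cis (2 * pi / real D)"
    by (simp add: root_unity_def cis_conv_exp mult_ac)
  then show ?thesis by (simp add: DeMoivre mult_ac)
qed

lemma root_unity_nonzero [simp]: "root_unity D \<noteq> 0"
  by (simp add: root_unity_def)

lemma root_unity_power_order: "D > 0 \<Longrightarrow> root_unity D ^ D = 1"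
  by (simp add: root_unity_power)

lemma root_unity_power_mod: "D > 0 \<Longrightarrow> root_unity D ^ (k mod D) = root_unity D ^ k"
  by (metis (no_types) div_mult_mod_eq mult.commute mult_1 power_add power_mult power_one
      root_unity_power_order)

text \<open>The powers with exponent below \<open>D\<close> enumerate the \<open>D\<close> distinct
  roots of unity; in other words \<open>root_unity D\<close> is primitive.\<close>

lemma root_unity_power_inj:
  assumes "a < D" "b < D"
  shows "root_unity D ^ a = root_unity D ^ b \<longleftrightarrow> a = b"
  using bij_betw_imp_inj_on[OF bij_betw_roots_unity[of D]] assms
  unfolding root_unity_power by (auto simp: inj_on_def)

text \<open>The base \<open>w\<close> of the powers satisfies \<open>w ^ D = 1\<close>, so the
  geometric sum vanishes unless \<open>w = 1\<close>, which by primitivity means that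
  \<open>b\<close> is the residue of \<open>q\<close>.\<close>

lemma root_unity_orthogonality:
  assumes "D > 0" "b < D"
  shows "(\<Sum>k<D. (root_unity D ^ b * inverse (root_unity D) ^ q) ^ k) =
    (if b = q mod D then of_nat D else 0)"
proof -
  define w where "w = root_unity D ^ b * inverse (root_unity D) ^ q"
  have "w = 1 \<longleftrightarrow> root_unity D ^ b = root_unity D ^ q"
    by (simp add: w_def field_simps power_inverse)
  also have "\<dots> \<longleftrightarrow> b = q mod D"
    using root_unity_power_inj[of b D "q mod D"] assms by (simp add: root_unity_power_mod)
  finally have w: "w = 1 \<longleftrightarrow> b = q mod D" .
  have "w ^ D = (root_unity D ^ D) ^ b * inverse (root_unity D ^ D) ^ q"
    by (simp add: w_def power_mult_distrib power_inverse flip: power_mult)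
      (simp add: mult.commute)
  then have "w ^ D = 1"
    using assms by (simp add: root_unity_power_order)
  then show ?thesis
    using w geometric_sum[of w D] by (auto simp: w_def)
qed

text \<open>Lowering an entry that is at least \<open>D\<close> by \<open>D\<close> changes neither
  \<open>g\<close> nor the residues but decreases the sum of the entries. When no such entry is
  left, the list equals its own reduction.\<close>

lemma periodic_eq_mod:
  fixes g :: "nat list \<Rightarrow> 'a"
  assumes "\<And>q j. length q = r \<Longrightarrow> j < r \<Longrightarrow> g (q[j := q ! j + D]) = g q"
    and "D > 0" and "length q = r"
  shows "g (map (\<lambda>x. x mod D) q) = g q"
  using \<open>length q = r\<close>
proof (induction "sum_list q" arbitrary: q rule: less_induct)
  case less
  show ?case
  proof (cases "\<exists>j<r. D \<le> q ! j")
    case False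
    then have "map (\<lambda>x. x mod D) q = q"
      using less.prems by (auto intro!: nth_equalityI)
    then show ?thesis by simp
  next
    case True
    then obtain j where j: "j < r" "D \<le> q ! j" by blast
    define q' where "q' = q[j := q ! j - D]"
    have len: "length q' = r" using less.prems by (simp add: q'_def)
    have q: "q = q'[j := q' ! j + D]"
      using j less.prems by (simp add: q'_def)
    have "sum_list q' < sum_list q"
      using j less.prems \<open>D > 0\<close> elem_le_sum_list[of j q] by (simp add: q'_def sum_list_update)
    then have "g (map (\<lambda>x. x mod D) q') = g q'"
      using less.hyps len by blast
    moreover have "map (\<lambda>x. x mod D) q = map (\<lambda>x. x mod D) q'"
      using len j by (subst q) (auto simp: nth_list_update intro!: nth_equalityI)
    moreover have "g q' = g q"
      using assms(1)[OF len j(1)] q by simp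
    ultimately show ?thesis by simp
  qed
qed

text \<open>After the two sums are exchanged, the sum over the frequencies \<open>k\<close> factors
  over the coordinates, and orthogonality leaves only the term where \<open>b\<close> is
  \<open>q\<close> reduced modulo \<open>D\<close>.\<close>

lemma periodic_fourier_inversion:
  fixes g :: "nat list \<Rightarrow> complex"
  assumes per: "\<And>q j. length q = r \<Longrightarrow> j < r \<Longrightarrow> g (q[j := q ! j + D]) = g q"
    and D: "D > 0" and q: "length q = r"
  shows "g q = (\<Sum>k | set k \<subseteq> {..<D} \<and> length k = r.
     (1 / of_nat D ^ r *
       (\<Sum>b | set b \<subseteq> {..<D} \<and> length b = r. g b * root_unity D ^ (\<Sum>i<r. k ! i * b ! i))) *
     (\<Prod>i<r. (inverse (root_unity D) ^ (k ! i)) ^ (q ! i)))" (is "_ = ?rhs")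
proof -
  let ?T = "{k. set k \<subseteq> {..<D} \<and> length k = r}"
  let ?\<omega> = "root_unity D"
  let ?q = "map (\<lambda>x. x mod D) q"
  have fin: "finite ?T" by (rule finite_lists_length_eq) simp
  have "?rhs = (\<Sum>k\<in>?T. \<Sum>b\<in>?T. 1 / of_nat D ^ r * g b *
      (\<Prod>i<r. (?\<omega> ^ (b ! i) * inverse ?\<omega> ^ (q ! i)) ^ (k ! i)))"
    by (simp add: sum_distrib_left sum_distrib_right power_sum power_mult_distrib
        prod.distrib mult_ac flip: power_mult)
  also have "\<dots> = (\<Sum>b\<in>?T. 1 / of_nat D ^ r * g b *
      (\<Prod>i<r. \<Sum>k<D. (?\<omega> ^ (b ! i) * inverse ?\<omega> ^ (q ! i)) ^ k))"
    by (subst sum.swap) (simp only: sum_distrib_left[symmetric] sum_lists_prod_power)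
  also have "\<dots> = (\<Sum>b\<in>?T. if b = ?q then g b else 0)"
  proof (rule sum.cong[OF refl])
    fix b assume b: "b \<in> ?T"
    then have "b ! i < D" if "i < r" for i
      using that nth_mem[of i b] by (auto simp del: nth_mem)
    then have "(\<Prod>i<r. \<Sum>k<D. (?\<omega> ^ (b ! i) * inverse ?\<omega> ^ (q ! i)) ^ k) =
        (\<Prod>i<r. if b ! i = q ! i mod D then of_nat D else (0::complex))"
      using D by (intro prod.cong) (auto simp: root_unity_orthogonality)
    also have "\<dots> = (if b = ?q then of_nat D ^ r else 0)"
    proof (cases "b = ?q")
      case True
      then show ?thesis using q by simp
    next
      case False
      then obtain i where "i < r" "b ! i \<noteq> q ! i mod D"
        using b q by (auto simp: list_eq_iff_nth_eq)
      then show ?thesis using False by (auto intro!: prod_zero)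
    qed
    finally show "1 / of_nat D ^ r * g b *
        (\<Prod>i<r. \<Sum>k<D. (?\<omega> ^ (b ! i) * inverse ?\<omega> ^ (q ! i)) ^ k) = (if b = ?q then g b else 0)"
      using D by simp
  qed
  also have "\<dots> = g ?q"
    using fin q D by (auto simp: sum.delta)
  also have "\<dots> = g q"
    using per D q by (rule periodic_eq_mod)
  finally show ?thesis by simp
qed

subsection \<open>Grouping by rearrangement\<close>

text \<open>Every list has exactly one weakly decreasing rearrangement, \<open>rev (sort k)\<close>;
  the fibre of this map over \<open>j\<close> consists of the rearrangements of
  \<open>j\<close>.\<close>

lemma sum_lists_group_permutations:
  fixes h :: "nat list \<Rightarrow> 'a::comm_monoid_add"
  assumes "finite A"
  shows "(\<Sum>k | set k \<subseteq> A \<and> length k = r. h k) =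
    (\<Sum>j | set j \<subseteq> A \<and> length j = r \<and> sorted_wrt (\<ge>) j.
      \<Sum>k\<in>permutations_of_multiset (mset j). h k)"
proof -
  let ?S = "{k. set k \<subseteq> A \<and> length k = r}"
  let ?T = "{j. set j \<subseteq> A \<and> length j = r \<and> sorted_wrt (\<ge>) j}"
  have S: "finite ?S" using assms by (rule finite_lists_length_eq)
  moreover have "finite ?T" by (rule finite_subset[OF _ S]) auto
  moreover have "(\<lambda>k. rev (sort k)) ` ?S \<subseteq> ?T" by (auto simp: sorted_wrt_rev)
  ultimately have "sum h ?S = (\<Sum>j\<in>?T. sum h {k \<in> ?S. rev (sort k) = j})"
    by (rule sum.group[symmetric])
  also have "\<dots> = (\<Sum>j\<in>?T. sum h (permutations_of_multiset (mset j)))"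
  proof (intro sum.cong refl)
    fix j assume j: "j \<in> ?T"
    then have "sorted (rev j)" by (simp add: sorted_wrt_rev)
    then have "rev (sort k) = j \<longleftrightarrow> mset k = mset j" for k
      by (metis mset_rev mset_sort properties_for_sort rev_rev_ident)
    then show "{k \<in> ?S. rev (sort k) = j} = permutations_of_multiset (mset j)"
      using j by (auto simp: permutations_of_multiset_def dest: mset_eq_setD mset_eq_length)
  qed
  finally show ?thesis .
qed

theorem theorem4p5:
  fixes r D n :: nat and F :: "int list \<Rightarrow> int" and \<xi> :: complex
  assumes "r > 0" and "D > 0"
    and "periodic_in_each r D F"
    and "\<xi> ^ D = 1"
  shows "exp_binom_sum r F \<xi> n =
    nested_sum (\<lambda>j. {0..if j = [] then D - 1 else last j}) r
      (\<lambda>j. coeff_c r D F \<xi> j * (1 + (\<Sum>i<r. root_unity D powi (- int (j ! i)))) ^ n)"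
proof -
  let ?\<omega> = "root_unity D"
  let ?T = "{k. set k \<subseteq> {..<D} \<and> length k = r}"
  \<comment> \<open>The reversal matches \<open>coeff_c\<close>, whose summation variable lists the
    \<open>b\<close>'s backwards. With it, \<open>a k\<close> below is the Fourier coefficient of
    \<open>g\<close> at \<open>k\<close> and equals the contribution of the single rearrangement
    \<open>k\<close> to \<open>coeff_c\<close>.\<close>
  define g where "g q = \<xi> powi F (map int (rev q))" for q
  define a where "a k = 1 / of_nat D ^ r * (\<Sum>b\<in>?T. g b * ?\<omega> ^ (\<Sum>i<r. k ! i * b ! i))" for k
  define B where
    "B q = (\<Prod>i<r. of_nat ((n - sum_list (take i q)) choose (q ! i)) :: complex)" for q
  define E where "E k = (1 + (\<Sum>i<r. inverse ?\<omega> ^ (k ! i))) ^ n" for k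
  have per: "g (q[j := q ! j + D]) = g q" if "length q = r" "j < r" for q j
  proof -
    \<comment> \<open>Reversal moves position \<open>j\<close> to \<open>r - Suc j\<close>, where
      the periodicity of \<open>F\<close> is then applied.\<close>
    have "rev (q[j := q ! j + D]) = (rev q)[r - Suc j := rev q ! (r - Suc j) + D]"
      using that by (simp add: rev_update rev_nth)
    moreover have "F ((map int (rev q))[r - Suc j := map int (rev q) ! (r - Suc j) + int D]) =
        F (map int (rev q))"
      using \<open>periodic_in_each r D F\<close> that
      unfolding periodic_in_each_def by (metis diff_Suc_less length_map length_rev less_nat_zero_code not_gr_zero)
    ultimately show ?thesis
      using that by (simp add: g_def map_update)
  qed
  have E_perm: "E k = E j" if "mset k = mset j" "length j = r" for k j
  proof -
    \<comment> \<open>The sum is symmetric in the entries, hence a function of the multiset.\<close>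
    have "(\<Sum>i<r. inverse ?\<omega> ^ (xs ! i)) = (\<Sum>x\<in>#mset xs. inverse ?\<omega> ^ x)" if "length xs = r" for xs
      using that sum_list_sum_nth[of "map (\<lambda>x. inverse ?\<omega> ^ x) xs"]
      unfolding mset_map[symmetric] sum_mset_sum_list by (simp add: atLeast0LessThan)
    then show ?thesis
      using that mset_eq_length[OF that(1)] by (simp add: E_def)
  qed

  have "exp_binom_sum r F \<xi> n = nested_sum (\<lambda>q. {0..n - sum_list q}) r
      (\<lambda>q. \<Sum>k\<in>?T. a k * (B q * (\<Prod>i<r. (inverse ?\<omega> ^ (rev k ! i)) ^ (q ! i))))"
    unfolding exp_binom_sum_def
  proof (rule nested_sum_cong)
    fix q :: "nat list" assume q: "length q = r"
    have "\<xi> powi F (map int q) = g (rev q)" by (simp add: g_def)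
    also have "\<dots> = (\<Sum>k\<in>?T. a k * (\<Prod>i<r. (inverse ?\<omega> ^ (k ! i)) ^ (rev q ! i)))"
      unfolding a_def using per \<open>D > 0\<close> q by (intro periodic_fourier_inversion) auto
    \<comment> \<open>Reindexing the product by \<open>i \<mapsto> r - Suc i\<close> shifts the
      reversal from \<open>q\<close> to \<open>k\<close>, so that \<open>q\<close> appears as in the
      binomial weight.\<close>
    also have "\<dots> = (\<Sum>k\<in>?T. a k * (\<Prod>i<r. (inverse ?\<omega> ^ (rev k ! i)) ^ (q ! i)))"
      using q
      by (intro sum.cong refl arg_cong2[where f = "(*)"])
        (subst prod.nat_diff_reindex[symmetric], auto simp: rev_nth intro!: prod.cong)
    finally show "(\<Prod>i<r. of_nat ((n - sum_list (take i q)) choose (q ! i))) * \<xi> powi F (map int q) =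
        (\<Sum>k\<in>?T. a k * (B q * (\<Prod>i<r. (inverse ?\<omega> ^ (rev k ! i)) ^ (q ! i))))"
      by (simp add: B_def sum_distrib_left mult_ac)
  qed
  \<comment> \<open>For each \<open>k\<close>, the multinomial theorem is applied with
    \<open>z i = inverse ?\<omega> ^ (rev k ! i)\<close>.\<close>
  also have "\<dots> = (\<Sum>k\<in>?T. a k * E (rev k))"
    unfolding nested_sum_sum_distrib nested_sum_distrib_left B_def nested_sum_multinomial E_def ..
  \<comment> \<open>The reversal disappears because \<open>E\<close> is invariant under
    rearrangement.\<close>
  also have "\<dots> = (\<Sum>k\<in>?T. a k * E k)"
    by (intro sum.cong refl arg_cong2[where f = "(*)"] E_perm) auto
  also have "\<dots> = (\<Sum>j | set j \<subseteq> {..<D} \<and> length j = r \<and> sorted_wrt (\<ge>) j.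
      \<Sum>k\<in>permutations_of_multiset (mset j). a k * E k)"
    by (rule sum_lists_group_permutations) simp
  also have "\<dots> = (\<Sum>j | set j \<subseteq> {..<D} \<and> length j = r \<and> sorted_wrt (\<ge>) j.
      coeff_c r D F \<xi> j * (1 + (\<Sum>i<r. ?\<omega> powi (- int (j ! i)))) ^ n)"
  proof (intro sum.cong refl)
    fix j assume j: "j \<in> {j. set j \<subseteq> {..<D} \<and> length j = r \<and> sorted_wrt (\<ge>) j}"
    have "{0..D - 1} = {..<D}" using \<open>D > 0\<close> by auto
    \<comment> \<open>Exchanging the sum over the \<open>b\<close>'s with the sum over
      rearrangements exhibits \<open>coeff_c\<close> as the total Fourier coefficient of the class
      of \<open>j\<close>, on which \<open>E\<close> is constant.\<close>
    then have "coeff_c r D F \<xi> j = (\<Sum>k\<in>permutations_of_multiset (mset j). a k)"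
      unfolding coeff_c_def a_def g_def
      by (simp only: nested_sum_const_range sum_distrib_left) (rule sum.swap)
    moreover have "(1 + (\<Sum>i<r. ?\<omega> powi (- int (j ! i)))) ^ n = E j"
      by (simp add: E_def power_int_minus power_inverse)
    moreover have "(\<Sum>k\<in>permutations_of_multiset (mset j). a k * E k) =
        (\<Sum>k\<in>permutations_of_multiset (mset j). a k * E j)"
      using j by (intro sum.cong refl arg_cong2[where f = "(*)"] E_perm)
        (auto dest: permutations_of_multisetD)
    ultimately show "(\<Sum>k\<in>permutations_of_multiset (mset j). a k * E k) =
        coeff_c r D F \<xi> j * (1 + (\<Sum>i<r. ?\<omega> powi (- int (j ! i)))) ^ n"
      by (simp add: sum_distrib_right)
  qed
  also have "\<dots> = nested_sum (\<lambda>j. {0..if j = [] then D - 1 else last j}) r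
      (\<lambda>j. coeff_c r D F \<xi> j * (1 + (\<Sum>i<r. ?\<omega> powi (- int (j ! i)))) ^ n)"
    by (rule nested_sum_decreasing[OF \<open>D > 0\<close>, symmetric])
  finally show ?thesis .
qed

end
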